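(* Let $\mathbb{M}^2(B)$ be an arbitrary Minkowski plane and let $T$ be a triangle in $\mathbb{M}^2(B)$. Let $T_m$ be a triangle whose sides are translates of the medians of $T$, and let $\mathbb{M}^2(\tilde B)$ be the plane with the norm (the antinorm) whose unit disk is the isoperimetrix $\tilde B$ of $B$. Then the following statements are equivalent. 1. $T$ is $AG$-quasiregular in $\mathbb{M}^2(B)$. 2. $T_m$ is equilateral in $\mathbb{M}^2(B)$. 3. $T_m$ is reduced in $\mathbb{M}^2(\tilde B)$. 4. $T_m$ has equal Minkowskian heights in $\mathbb{M}^2(\tilde B)$. Furthermore, the following are equivalent. 1. $T$ is equilateral in $\mathbb{M}^2(B)$. 2. $T_m$ is $AG$-quasiregular in $\mathbb{M}^2(B)$. 3. $T$ is reduced in $\mathbb{M}^2(\tilde B)$. 4. $T$ has equal Minkowskian heights in $\mathbb{M}^2(\tilde B)$.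
   Context: $\mathbb{M}^2(B)$ denotes $\mathbb{R}^2$ with the norm whose unit ball is $B$ (a convex body with nonempty interior, symmetric about the origin). Fix an auxiliary inner product $\langle\cdot,\cdot\rangle$ on $\mathbb{R}^2$ and let $B^*=\{y:\langle x,y\rangle\le1\text{ for all }x\in B\}$. The isoperimetrix $\tilde B$ of $B$ is the body obtained by rotating $B^*$ by the angle $\pi/2$ about the origin (with respect to the auxiliary inner product). The medians of a triangle are the segments joining each vertex to the midpoint of the opposite side. A triangle is equilateral in a norm if its three sides have equal length in that norm. A triangle is $AG$-quasiregular in a norm if its centroid is a circumcenter, i.e. its three vertices have the same distance (in that norm) to the centroid. The Minkowskian distance of a point $P$ to a line $\ell$ is $\min_{X\in\ell}\|P-X\|$; the Minkowskian height of a triangle with respect to a vertex is the Minkowskian distance of this vertex to the line containing the opposite side. The minimum width of a convex body in a normed plane is the minimum, over all pairs of parallel supporting lines of the body, of the Minkowskian distance between the two lines. A convex body is reduced with respect to a norm if every convex body properly contained in it has strictly smaller minimum width with respect to that norm. *)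

theory Defs
  imports "HOL-Analysis.Analysis"
begin

definition convex_body :: "(real^2) set \<Rightarrow> bool" where
  "convex_body K \<longleftrightarrow> compact K \<and> convex K \<and> K \<noteq> {}"

definition unit_ball :: "(real^2) set \<Rightarrow> bool" where
  "unit_ball B \<longleftrightarrow> convex_body B \<and> interior B \<noteq> {} \<and> (\<forall>x\<in>B. - x \<in> B)"

definition norm_of :: "(real^2) set \<Rightarrow> real^2 \<Rightarrow> real" where
  "norm_of B x = Inf {t. 0 \<le> t \<and> x \<in> (\<lambda>y. t *\<^sub>R y) ` B}"

definition inner_product :: "(real^2 \<Rightarrow> real^2 \<Rightarrow> real) \<Rightarrow> bool" where
  "inner_product ip \<longleftrightarrow>
     bilinear ip \<and> (\<forall>x y. ip x y = ip y x) \<and> (\<forall>x. x \<noteq> 0 \<longrightarrow> 0 < ip x x)"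

definition polar_body :: "(real^2 \<Rightarrow> real^2 \<Rightarrow> real) \<Rightarrow> (real^2) set \<Rightarrow> (real^2) set" where
  "polar_body ip B = {y. \<forall>x\<in>B. ip x y \<le> 1}"

text \<open>Both orientations of the basis \<open>u, v\<close> are admitted, so for a given angle there are in
  general two rotations. For a right angle they differ by the sign and give the same
  isoperimetrix of a body that is symmetric about the origin.\<close>

definition rotation :: "(real^2 \<Rightarrow> real^2 \<Rightarrow> real) \<Rightarrow> real \<Rightarrow> (real^2 \<Rightarrow> real^2) \<Rightarrow> bool" where
  "rotation ip \<theta> R \<longleftrightarrow> linear R \<and>
     (\<exists>u v. ip u u = 1 \<and> ip v v = 1 \<and> ip u v = 0 \<and>
        R u = cos \<theta> *\<^sub>R u + sin \<theta> *\<^sub>R v \<and>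
        R v = - sin \<theta> *\<^sub>R u + cos \<theta> *\<^sub>R v)"

text \<open>\<open>R\<close> stands for a rotation by a right angle with respect to \<open>ip\<close>.\<close>

definition isoperimetrix ::
    "(real^2 \<Rightarrow> real^2 \<Rightarrow> real) \<Rightarrow> (real^2 \<Rightarrow> real^2) \<Rightarrow> (real^2) set \<Rightarrow> (real^2) set" where
  "isoperimetrix ip R B = R ` polar_body ip B"

definition is_triangle :: "real^2 \<Rightarrow> real^2 \<Rightarrow> real^2 \<Rightarrow> bool" where
  "is_triangle a b c \<longleftrightarrow> \<not> collinear {a, b, c}"

definition sides :: "real^2 \<Rightarrow> real^2 \<Rightarrow> real^2 \<Rightarrow> (real^2) set set" where
  "sides a b c = {closed_segment b c, closed_segment c a, closed_segment a b}"

definition medians :: "real^2 \<Rightarrow> real^2 \<Rightarrow> real^2 \<Rightarrow> (real^2) set set" where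
  "medians a b c =
     {closed_segment a (midpoint b c), closed_segment b (midpoint c a), closed_segment c (midpoint a b)}"

definition translate_of :: "(real^2) set \<Rightarrow> (real^2) set \<Rightarrow> bool" where
  "translate_of S S' \<longleftrightarrow> (\<exists>v. S = (\<lambda>x. v + x) ` S')"

definition median_triangle ::
    "real^2 \<Rightarrow> real^2 \<Rightarrow> real^2 \<Rightarrow> real^2 \<Rightarrow> real^2 \<Rightarrow> real^2 \<Rightarrow> bool" where
  "median_triangle a b c p q r \<longleftrightarrow> is_triangle p q r \<and>
     (\<exists>f. bij_betw f (medians a b c) (sides p q r) \<and> (\<forall>m\<in>medians a b c. translate_of (f m) m))"

text \<open>In the following definitions, \<open>N\<close> is the norm of the plane.\<close>

definition equilateral ::
    "(real^2 \<Rightarrow> real) \<Rightarrow> real^2 \<Rightarrow> real^2 \<Rightarrow> real^2 \<Rightarrow> bool" where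
  "equilateral N a b c \<longleftrightarrow> N (b - c) = N (c - a) \<and> N (c - a) = N (a - b)"

definition circumcenter ::
    "(real^2 \<Rightarrow> real) \<Rightarrow> real^2 \<Rightarrow> real^2 \<Rightarrow> real^2 \<Rightarrow> real^2 \<Rightarrow> bool" where
  "circumcenter N x a b c \<longleftrightarrow> N (a - x) = N (b - x) \<and> N (b - x) = N (c - x)"

definition centroid :: "real^2 \<Rightarrow> real^2 \<Rightarrow> real^2 \<Rightarrow> real^2" where
  "centroid a b c = (1 / 3) *\<^sub>R (a + b + c)"

definition AG_quasiregular ::
    "(real^2 \<Rightarrow> real) \<Rightarrow> real^2 \<Rightarrow> real^2 \<Rightarrow> real^2 \<Rightarrow> bool" where
  "AG_quasiregular N a b c \<longleftrightarrow> circumcenter N (centroid a b c) a b c"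

definition mink_dist :: "(real^2 \<Rightarrow> real) \<Rightarrow> (real^2) set \<Rightarrow> (real^2) set \<Rightarrow> real" where
  "mink_dist N S S' = Inf {N (x - y) | x y. x \<in> S \<and> y \<in> S'}"

definition mink_height ::
    "(real^2 \<Rightarrow> real) \<Rightarrow> real^2 \<Rightarrow> real^2 \<Rightarrow> real^2 \<Rightarrow> real" where
  "mink_height N a b c = mink_dist N {a} (affine hull {b, c})"

definition equal_heights ::
    "(real^2 \<Rightarrow> real) \<Rightarrow> real^2 \<Rightarrow> real^2 \<Rightarrow> real^2 \<Rightarrow> bool" where
  "equal_heights N a b c \<longleftrightarrow>
     mink_height N a b c = mink_height N b c a \<and> mink_height N b c a = mink_height N c a b"

text \<open>The body lies between the two lines, which therefore coincide only for a body contained in a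
  line. The product \<open>n \<bullet> x\<close> only serves to write equations of lines; it is unrelated to the
  auxiliary inner product of the isoperimetrix.\<close>

definition parallel_supporting_lines ::
    "(real^2) set \<Rightarrow> (real^2) set \<Rightarrow> (real^2) set \<Rightarrow> bool" where
  "parallel_supporting_lines K l l' \<longleftrightarrow>
     (\<exists>n s s'. n \<noteq> 0 \<and> l = {x. n \<bullet> x = s} \<and> l' = {x. n \<bullet> x = s'} \<and>
        l \<inter> K \<noteq> {} \<and> l' \<inter> K \<noteq> {} \<and> (\<forall>x\<in>K. s \<le> n \<bullet> x \<and> n \<bullet> x \<le> s'))"

definition min_width :: "(real^2 \<Rightarrow> real) \<Rightarrow> (real^2) set \<Rightarrow> real" where
  "min_width N K = Inf {mink_dist N l l' | l l'. parallel_supporting_lines K l l'}"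

definition reduced_body :: "(real^2 \<Rightarrow> real) \<Rightarrow> (real^2) set \<Rightarrow> bool" where
  "reduced_body N K \<longleftrightarrow> convex_body K \<and>
     (\<forall>K'. convex_body K' \<and> K' \<subset> K \<longrightarrow> min_width N K' < min_width N K)"

end

theory Submission
  imports Defs
begin

text \<open>The distance in the antinorm between two parallel lines with direction \<open>d\<close> is, up to a constant
  factor, the area of a parallelogram with side \<open>d\<close> spanned between them, divided by \<open>N d\<close>. So the
  heights of a triangle in the antinorm are inversely proportional to its side lengths in \<open>N\<close>, and
  its minimum width is the smallest height, because a convex function attains its maximum over a
  hexagon at a vertex. If a side has length less than the maximum side length \<open>M\<close>, the tip at the
  opposite vertex can be cut off parallel to that side without reducing the minimum width, as long
  as the tip has ratio at most \<open>1 - l / M\<close>, where \<open>l\<close> is the length of that side. If all sides are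
  equal, a missing vertex lowers the width in the direction of the opposite side. The vectors
  from the centroid to the vertices are \<open>2/3\<close> of the medians, and the medians of the median triangle
  are, up to a common sign, \<open>3/4\<close> of the sides of the original triangle.\<close>

section \<open>The planar area form\<close>

text \<open>For \<open>d \<noteq> 0\<close> the level sets of \<open>cross2 d\<close> are the lines
  with direction \<open>d\<close>. Parallel lines are thus indexed by a direction, whose length in
  \<open>N\<close> governs their distance in the antinorm.\<close>

definition cross2 :: "real^2 \<Rightarrow> real^2 \<Rightarrow> real" where
  "cross2 x y = x $ 1 * y $ 2 - x $ 2 * y $ 1"

lemma cross2_simps:
  "cross2 (x + y) z = cross2 x z + cross2 y z"
  "cross2 z (x + y) = cross2 z x + cross2 z y"
  "cross2 (x - y) z = cross2 x z - cross2 y z"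
  "cross2 z (x - y) = cross2 z x - cross2 z y"
  "cross2 (k *\<^sub>R x) z = k * cross2 x z"
  "cross2 z (k *\<^sub>R x) = k * cross2 z x"
  "cross2 (- x) z = - cross2 x z"
  "cross2 z (- x) = - cross2 z x"
  "cross2 x x = 0"
  "cross2 0 x = 0"
  "cross2 x 0 = 0"
  by (simp_all add: cross2_def algebra_simps)

lemma cross2_swap: "cross2 y x = - cross2 x y"
  by (simp add: cross2_def)

lemma bounded_linear_cross2: "bounded_linear (cross2 x)"
  by (intro linear_linear[THEN iffD2] linearI) (simp_all add: cross2_simps)

lemma continuous_on_cross2 [continuous_intros]: "continuous_on S (cross2 x)"
  by (rule linear_continuous_on[OF bounded_linear_cross2])

lemma cross2_cramer: "cross2 u v *\<^sub>R x = cross2 x v *\<^sub>R u + cross2 u x *\<^sub>R v"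
  by (simp add: vec_eq_iff forall_2 cross2_def algebra_simps)

lemma cross2_eq_0D:
  assumes "cross2 d z = 0" "d \<noteq> 0"
  obtains t where "z = t *\<^sub>R d"
proof -
  \<comment> \<open>The two sides differ by \<open>cross2 d z\<close> times \<open>d\<close> turned
    by a right angle.\<close>
  have "(d \<bullet> d) *\<^sub>R z = (d \<bullet> z) *\<^sub>R d"
    using assms(1) unfolding vec_eq_iff forall_2 inner_vec_def sum_2 cross2_def inner_real_def
    by (simp, algebra)
  then have "z = ((d \<bullet> z) / (d \<bullet> d)) *\<^sub>R d"
    using assms(2)
    by (metis divide_inverse_commute inner_eq_zero_iff left_inverse scaleR_one scaleR_scaleR)
  then show ?thesis by (rule that)
qed

text \<open>Supporting lines are given by a normal \<open>n\<close>, distances by a direction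
  \<open>d\<close>; this lemma and the next pass between the two by a quarter turn.\<close>

lemma inner_eq_cross2: "n \<bullet> x = cross2 (vector [n $ 2, - n $ 1]) x"
  by (simp add: inner_vec_def sum_2 cross2_def vector_2)

lemma cross2_eq_inner: "cross2 d x = vector [- d $ 2, d $ 1] \<bullet> x"
  by (simp add: inner_vec_def sum_2 cross2_def vector_2)

lemma cross2_le_norm: "\<bar>cross2 x y\<bar> \<le> 2 * norm x * norm y"
proof -
  have "\<bar>x $ 1 * y $ 2\<bar> \<le> norm x * norm y" "\<bar>x $ 2 * y $ 1\<bar> \<le> norm x * norm y"
    by (auto simp: abs_mult intro!: mult_mono component_le_norm_cart)
  then show ?thesis unfolding cross2_def by linarith
qed

lemma triangle_cross2_nonzero:
  assumes "is_triangle a b c"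
  shows "cross2 (b - a) (c - a) \<noteq> 0"
proof
  assume 0: "cross2 (b - a) (c - a) = 0"
  have n: "\<not> collinear {0, b - a, c - a}"
    using assms collinear_3[of b a c] unfolding is_triangle_def by (simp add: insert_commute)
  then have "b - a \<noteq> 0" by (metis collinear_lemma)
  from cross2_eq_0D[OF 0 this] n show False by (metis collinear_lemma)
qed

text \<open>Twice the signed area is the same at every vertex, so facts proved for \<open>a\<close>
  carry over to \<open>b\<close> and \<open>c\<close> by cyclic relabelling.\<close>

lemma cross2_triangle_cyclic:
  fixes a b c :: "real^2"
  shows "cross2 (c - b) (a - b) = cross2 (b - a) (c - a)"
    and "cross2 (a - c) (b - c) = cross2 (b - a) (c - a)"
  by (simp_all add: cross2_def algebra_simps)

section \<open>Planar norms and unit balls\<close>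

locale plane_norm =
  fixes N :: "real^2 \<Rightarrow> real"
  assumes N_triangle: "N (x + y) \<le> N x + N y"
    and N_scale: "N (k *\<^sub>R x) = \<bar>k\<bar> * N x"
    and N_pos: "x \<noteq> 0 \<Longrightarrow> 0 < N x"
begin

lemma N_zero [simp]: "N 0 = 0"
  using N_scale[of 0 0] by simp

lemma N_minus [simp]: "N (- x) = N x"
  using N_scale[of "-1" x] by simp

lemma N_diff_commute: "N (x - y) = N (y - x)"
  using N_minus[of "x - y"] by simp

lemma N_nonneg: "0 \<le> N x"
  using N_pos[of x] by (cases "x = 0") auto

lemma convex_ball_N: "convex {x. N x < 1}"
proof (intro convexI, clarsimp)
  fix x y and u v :: real
  assume *: "N x < 1" "N y < 1" "0 \<le> u" "0 \<le> v" "u + v = 1"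
  have "N (u *\<^sub>R x + v *\<^sub>R y) \<le> u * N x + v * N y"
    using N_triangle[of "u *\<^sub>R x" "v *\<^sub>R y"] * by (simp add: N_scale)
  also have "\<dots> < 1" using * by (intro convex_bound_lt) auto
  finally show "N (u *\<^sub>R x + v *\<^sub>R y) < 1" .
qed

text \<open>A line separates the open unit ball from the normalised \<open>d\<close>; its normal is
  scaled to take the value \<open>N d\<close> at \<open>d\<close>. It later yields the point of a
  line where the antinorm is least.\<close>

lemma supporting_functional:
  assumes "d \<noteq> 0"
  obtains n where "n \<bullet> d = N d" "\<And>x. n \<bullet> x \<le> N x"
proof -
  define e where "e = (1 / N d) *\<^sub>R d"
  have Nd: "N d > 0" using N_pos assms .
  have Ne: "N e = 1" using Nd by (simp add: e_def N_scale)
  have "{x. N x < 1} \<noteq> {}" by (auto intro!: exI[of _ 0])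
  then obtain m \<beta> where m: "m \<noteq> 0" "\<forall>x\<in>{x. N x < 1}. m \<bullet> x \<le> \<beta>" "\<forall>x\<in>{e}. \<beta> \<le> m \<bullet> x"
    using separating_hyperplane_sets[of "{x. N x < 1}" "{e}"] convex_ball_N Ne by auto
  have le: "m \<bullet> x \<le> (m \<bullet> e) * N x" for x
  proof -
    \<comment> \<open>Only points of norm below 1 are separated from \<open>e\<close>, so
      \<open>x\<close> is divided by some \<open>s > N x\<close>; letting \<open>s\<close> decrease
      to \<open>N x\<close> gives the claim.\<close>
    have *: "m \<bullet> x \<le> (m \<bullet> e) * s" if "s > N x" for s
    proof -
      have s: "s > 0" using N_nonneg[of x] that by linarith
      then have "N ((1 / s) *\<^sub>R x) < 1" using that by (simp add: N_scale)
      then have "m \<bullet> ((1 / s) *\<^sub>R x) \<le> m \<bullet> e" using m(2,3) by fastforce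
      then show ?thesis using s by (simp add: field_simps)
    qed
    have "((\<lambda>s. (m \<bullet> e) * s) \<longlongrightarrow> (m \<bullet> e) * N x) (at_right (N x))"
      by (intro tendsto_intros)
    then show ?thesis
      by (rule tendsto_lowerbound) (auto simp: eventually_at_filter * intro!: always_eventually)
  qed
  have "0 < m \<bullet> m" using m(1) by simp
  then have pos: "0 < m \<bullet> e"
    using le[of m] N_pos[OF m(1)] by (meson less_le_trans zero_less_mult_pos2)
  show ?thesis
  proof
    have "m \<bullet> d = (m \<bullet> e) * N d" using Nd by (simp add: e_def)
    then show "((1 / (m \<bullet> e)) *\<^sub>R m) \<bullet> d = N d" using pos by simp
    show "((1 / (m \<bullet> e)) *\<^sub>R m) \<bullet> x \<le> N x" for x
      using le[of x] pos by (simp add: field_simps)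
  qed
qed

end

section \<open>The gauge of a unit ball is a norm\<close>

lemma norm_of_le:
  assumes "y \<in> B" "0 \<le> t"
  shows "norm_of B (t *\<^sub>R y) \<le> t"
  unfolding norm_of_def using assms
  by (intro cInf_lower) (auto simp: bdd_below_def intro!: exI[of _ 0])

text \<open>A ball around an interior point \<open>x\<close> moves to the origin: for small
  \<open>y\<close> the points \<open>x + y\<close> and \<open>- (x - y)\<close> lie in
  \<open>B\<close> and have midpoint \<open>y\<close>.\<close>

lemma unit_ball_contains_ball:
  assumes "unit_ball B"
  obtains e where "e > 0" "cball 0 e \<subseteq> B"
proof -
  obtain x where "x \<in> interior B" using assms unfolding unit_ball_def by blast
  then obtain e where e: "e > 0" "cball x e \<subseteq> B"
    unfolding mem_interior_cball by blast
  have "y \<in> B" if "norm y \<le> e" for y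
  proof -
    have 1: "x + y \<in> B" "x - y \<in> B"
      using e(2) that by (auto simp: subset_iff dist_norm)
    then have "- (x - y) \<in> B" using assms unfolding unit_ball_def by blast
    moreover have "y = (1/2) *\<^sub>R (x + y) + (1/2) *\<^sub>R (- (x - y))"
      by (simp add: vec_eq_iff field_simps)
    moreover have "convex B" using assms unfolding unit_ball_def convex_body_def by blast
    ultimately show ?thesis
      using 1(1) convexD[of B "x + y" "- (x - y)" "1/2" "1/2"] by simp
  qed
  then show ?thesis using e(1) that by (auto simp: subset_iff)
qed

text \<open>This stands in for attainment of the infimum in \<open>norm_of\<close>: some admissible
  \<open>t < s\<close> exists, and \<open>(t / s) *\<^sub>R y\<close> stays in \<open>B\<close>
  because \<open>B\<close> is convex and contains 0.\<close>

lemma unit_ball_absorbs: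
  assumes "unit_ball B" "norm_of B x < s"
  obtains y where "y \<in> B" "x = s *\<^sub>R y"
proof -
  obtain e where e: "e > 0" "cball 0 e \<subseteq> B" using unit_ball_contains_ball assms(1) .
  let ?S = "{t. 0 \<le> t \<and> x \<in> (\<lambda>y. t *\<^sub>R y) ` B}"
  \<comment> \<open>\<open>x\<close> lies in this multiple of the ball of radius \<open>e\<close>
    inside \<open>B\<close>, so the infimum runs over a nonempty set.\<close>
  have "norm x / e \<in> ?S"
  proof (cases "x = 0")
    case True
    then show ?thesis using e by (auto intro!: image_eqI[of _ _ 0])
  next
    case False
    then have "x = (norm x / e) *\<^sub>R ((e / norm x) *\<^sub>R x)" using e(1) by simp
    moreover have "(e / norm x) *\<^sub>R x \<in> B" using e False by (auto simp: subset_iff)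
    ultimately show ?thesis using e(1) by (simp del: scaleR_scaleR add: image_iff) blast
  qed
  then have ne: "?S \<noteq> {}" by (rule ex_in_conv[THEN iffD1, OF exI])
  obtain t where t: "t \<in> ?S" "t < s"
    using cInf_lessD[OF ne assms(2)[unfolded norm_of_def]] by (rule bexE)
  then obtain y where y: "y \<in> B" "x = t *\<^sub>R y" "0 \<le> t" by blast
  have "0 \<in> B" using e(1) subsetD[OF e(2), of 0] by simp
  moreover have "convex B" using assms unfolding unit_ball_def convex_body_def by blast
  ultimately have "(t / s) *\<^sub>R y \<in> B"
    using convexD[of B y 0 "t / s" "1 - t / s"] y(1,3) t(2) by simp
  moreover have "x = s *\<^sub>R ((t / s) *\<^sub>R y)" using y(2,3) t(2) by simp
  ultimately show ?thesis by (rule that)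
qed

lemma norm_of_nonneg:
  assumes "unit_ball B"
  shows "0 \<le> norm_of B x"
proof (rule ccontr)
  assume "\<not> 0 \<le> norm_of B x"
  then have neg: "norm_of B x < 0" by simp
  then obtain y where "y \<in> B" "x = (norm_of B x / 2) *\<^sub>R y"
    using unit_ball_absorbs[OF assms, of x "norm_of B x / 2"] by auto
  then have y: "- y \<in> B" "x = (- norm_of B x / 2) *\<^sub>R (- y)"
    using assms unfolding unit_ball_def by auto
  \<comment> \<open>The case \<open>s = 0\<close> puts 0 into the set under the infimum; a nonempty
    set of nonnegative numbers has a nonnegative infimum.\<close>
  obtain z where z: "z \<in> B" "x = 0 *\<^sub>R z"
    using unit_ball_absorbs[OF assms, of x 0] neg by auto
  have "Inf {t. 0 \<le> t \<and> x \<in> (\<lambda>y. t *\<^sub>R y) ` B} \<ge> 0"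
    using z by (intro cInf_greatest) auto
  with neg show False by (simp add: norm_of_def)
qed

lemma norm_of_plane_norm:
  assumes B: "unit_ball B"
  shows "plane_norm (norm_of B)"
proof
  fix x y :: "real^2" and k :: real
  have cv: "convex B" using B unfolding unit_ball_def convex_body_def by blast
  show "norm_of B (x + y) \<le> norm_of B x + norm_of B y"
  proof (rule field_le_epsilon)
    fix e :: real assume e: "e > 0"
    define s t where "s = norm_of B x + e/2" and "t = norm_of B y + e/2"
    have st: "s > 0" "t > 0" using norm_of_nonneg[OF B] e by (auto simp: s_def t_def add_nonneg_pos)
    obtain u where u: "u \<in> B" "x = s *\<^sub>R u"
      using unit_ball_absorbs[OF B, of x s] e by (auto simp: s_def)
    obtain v where v: "v \<in> B" "y = t *\<^sub>R v"
      using unit_ball_absorbs[OF B, of y t] e by (auto simp: t_def)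
    have "(s / (s + t)) *\<^sub>R u + (t / (s + t)) *\<^sub>R v \<in> B"
      using st u v by (intro convexD[OF cv]) (auto simp flip: add_divide_distrib)
    moreover have "x + y = (s + t) *\<^sub>R ((s / (s + t)) *\<^sub>R u + (t / (s + t)) *\<^sub>R v)"
      using st u v by (simp add: scaleR_add_right)
    ultimately have "norm_of B (x + y) \<le> s + t"
      using st norm_of_le by simp
    then show "norm_of B (x + y) \<le> norm_of B x + norm_of B y + e"
      by (simp add: s_def t_def)
  qed
  have le: "norm_of B (k *\<^sub>R x) \<le> \<bar>k\<bar> * norm_of B x" for k x
  proof (rule field_le_epsilon)
    fix e :: real assume e: "e > 0"
    \<comment> \<open>This slack stays below \<open>e\<close> after multiplication by
      \<open>\<bar>k\<bar>\<close>, and it is defined for \<open>k = 0\<close> too.\<close>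
    define s where "s = norm_of B x + e / (\<bar>k\<bar> + 1)"
    have s: "s > norm_of B x" "s \<ge> 0"
      using norm_of_nonneg[OF B, of x] e by (auto simp: s_def)
    obtain u where u: "u \<in> B" "x = s *\<^sub>R u"
      using unit_ball_absorbs[OF B s(1)] .
    have u': "sgn k *\<^sub>R u \<in> B \<or> k = 0" using B u(1) by (auto simp: sgn_if unit_ball_def)
    have "norm_of B (k *\<^sub>R x) \<le> \<bar>k\<bar> * s"
    proof (cases "k = 0")
      case True
      then show ?thesis using norm_of_le[OF u(1), of 0] by simp
    next
      case False
      have "k *\<^sub>R x = (\<bar>k\<bar> * s) *\<^sub>R (sgn k *\<^sub>R u)"
        using u(2) by (simp add: sgn_if)
      then show ?thesis using norm_of_le[of "sgn k *\<^sub>R u" B "\<bar>k\<bar> * s"] u' False s by simp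
    qed
    also have "\<bar>k\<bar> * s \<le> \<bar>k\<bar> * norm_of B x + e"
    proof -
      have "\<bar>k\<bar> * (e / (\<bar>k\<bar> + 1)) \<le> e" using e by (simp add: field_simps)
      then show ?thesis by (simp add: s_def ring_distribs)
    qed
    finally show "norm_of B (k *\<^sub>R x) \<le> \<bar>k\<bar> * norm_of B x + e" .
  qed
  show "norm_of B (k *\<^sub>R x) = \<bar>k\<bar> * norm_of B x"
  proof (cases "k = 0")
    case True
    then show ?thesis using le[of k x] norm_of_nonneg[OF B, of 0] by simp
  next
    case False
    \<comment> \<open>The reverse inequality is \<open>le\<close> for the factor
      \<open>1 / k\<close> at the vector \<open>k *\<^sub>R x\<close>.\<close>
    have "norm_of B x \<le> \<bar>1 / k\<bar> * norm_of B (k *\<^sub>R x)"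
      using le[of "1 / k" "k *\<^sub>R x"] False by simp
    then have "\<bar>k\<bar> * norm_of B x \<le> norm_of B (k *\<^sub>R x)"
      using False by (simp add: field_simps)
    with le[of k x] show ?thesis by simp
  qed
  assume x: "x \<noteq> 0"
  have "bounded B" using B unfolding unit_ball_def convex_body_def
    using compact_imp_bounded by blast
  then obtain C where C: "C > 0" "\<And>y. y \<in> B \<Longrightarrow> norm y \<le> C"
    by (auto simp: bounded_pos)
  have "norm x / C \<le> norm_of B x"
  proof (rule field_le_epsilon)
    fix e :: real assume e: "e > 0"
    then obtain y where y: "y \<in> B" "x = (norm_of B x + e) *\<^sub>R y"
      using unit_ball_absorbs[OF B, of x "norm_of B x + e"] by auto
    have "norm x = \<bar>norm_of B x + e\<bar> * norm y" using y(2) by (metis norm_scaleR)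
    also have "\<dots> = (norm_of B x + e) * norm y"
      using e norm_of_nonneg[OF B, of x] by simp
    also have "\<dots> \<le> (norm_of B x + e) * C"
      using C y e norm_of_nonneg[OF B, of x] by (intro mult_left_mono) auto
    finally show "norm x / C \<le> norm_of B x + e" using C by (simp add: field_simps)
  qed
  moreover have "norm x / C > 0" using x C by simp
  ultimately show "0 < norm_of B x" by linarith
qed

section \<open>Distances and widths in the antinorm\<close>

text \<open>In a basis \<open>u\<close>, \<open>v\<close> orthonormal for \<open>ip\<close>,
  \<open>ip x y\<close> is \<open>cross2 x (R y)\<close> divided by \<open>cross2 u v\<close>.
  Rotating the polar body thus gives the polar of \<open>B\<close> for the area form, and the
  auxiliary product survives only in the factor \<open>\<mu>\<close>.\<close>

lemma isoperimetrix_cross2: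
  assumes ip: "inner_product ip" and R: "rotation ip (pi / 2) R" and B: "unit_ball B"
  obtains \<mu> where "\<mu> > 0" "isoperimetrix ip R B = {z. \<forall>x\<in>B. \<mu> * cross2 x z \<le> 1}"
proof -
  obtain u v where uv: "ip u u = 1" "ip v v = 1" "ip u v = 0" "R u = v" "R v = - u"
    and lin: "linear R"
    using R unfolding rotation_def by auto
  have bl: "bilinear ip" and sym: "\<And>x y. ip x y = ip y x"
    using ip unfolding inner_product_def by auto
  note bls = bilinear_ladd[OF bl] bilinear_radd[OF bl] bilinear_lmul[OF bl] bilinear_rmul[OF bl]
    bilinear_lzero[OF bl] bilinear_rzero[OF bl]
  define \<delta> where "\<delta> = cross2 u v"
  have "\<delta> \<noteq> 0"
  proof
    assume "\<delta> = 0"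
    moreover have "u \<noteq> 0" using uv(1) bls(5) by auto
    ultimately obtain t where t: "v = t *\<^sub>R u"
      using cross2_eq_0D[of u v] unfolding \<delta>_def by blast
    with uv bls show False by simp
  qed
  have repr: "\<exists>s t. x = s *\<^sub>R u + t *\<^sub>R v" for x
  proof -
    have "(1 / \<delta>) *\<^sub>R (\<delta> *\<^sub>R x) = (cross2 x v / \<delta>) *\<^sub>R u + (cross2 u x / \<delta>) *\<^sub>R v"
      unfolding \<delta>_def cross2_cramer[of u v x] by (simp add: scaleR_add_right)
    then show ?thesis using \<open>\<delta> \<noteq> 0\<close> by auto
  qed
  have ip_eq: "ip x y = cross2 x (R y) / \<delta>" for x y
  proof -
    obtain s t where x: "x = s *\<^sub>R u + t *\<^sub>R v" using repr by blast
    obtain s' t' where y: "y = s' *\<^sub>R u + t' *\<^sub>R v" using repr by blast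
    have "R y = s' *\<^sub>R v - t' *\<^sub>R u"
      by (simp add: y linear_add[OF lin] linear_scale[OF lin] uv)
    then have "cross2 x (R y) = (s * s' + t * t') * \<delta>"
      using cross2_swap[of u v] by (simp only: x cross2_simps \<delta>_def) (simp add: algebra_simps)
    moreover have "ip x y = s * s' + t * t'"
      by (simp add: x y bls uv sym[of v u])
    ultimately show ?thesis using \<open>\<delta> \<noteq> 0\<close> by simp
  qed
  have surj: "\<exists>y. R y = z" for z
  proof -
    obtain s t where z: "z = s *\<^sub>R u + t *\<^sub>R v" using repr by blast
    have "R (t *\<^sub>R u - s *\<^sub>R v) = z"
      by (simp add: z linear_diff[OF lin] linear_scale[OF lin] uv)
    then show ?thesis by blast
  qed
  have iso: "isoperimetrix ip R B = {z. \<forall>x\<in>B. cross2 x z / \<delta> \<le> 1}"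
    unfolding isoperimetrix_def polar_body_def ip_eq using surj by (auto simp: image_iff) metis
  have sB: "(- x) \<in> B \<longleftrightarrow> x \<in> B" for x
    using B unfolding unit_ball_def by (metis minus_minus)
  \<comment> \<open>If the basis is negatively oriented, replacing \<open>x\<close> by
    \<open>- x\<close> in the symmetric \<open>B\<close> restores a positive factor.\<close>
  have "(\<forall>x\<in>B. cross2 x z / \<delta> \<le> 1) \<longleftrightarrow> (\<forall>x\<in>B. 1 / \<bar>\<delta>\<bar> * cross2 x z \<le> 1)" for z
  proof (cases "\<delta> > 0")
    case False
    have "(\<forall>x\<in>B. cross2 x z / \<delta> \<le> 1) \<longleftrightarrow> (\<forall>x\<in>B. cross2 (- x) z / \<delta> \<le> 1)"
      using sB by (metis minus_minus)
    with False show ?thesis by (simp add: cross2_simps)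
  qed simp
  with iso \<open>\<delta> \<noteq> 0\<close> show ?thesis by (intro that[of "1 / \<bar>\<delta>\<bar>"]) auto
qed

text \<open>Later arguments see the antinorm only through this infimum: the least \<open>N'\<close>
  on a line parallel to \<open>d\<close> is an area divided by the length
  \<open>N d\<close>.\<close>

locale antinorm_plane = plane_norm N for N +
  fixes N' :: "real^2 \<Rightarrow> real" and \<mu> :: real
  assumes mu_pos: "0 < \<mu>"
    and Inf_antinorm: "d \<noteq> 0 \<Longrightarrow> Inf (N' ` {z. cross2 d z = h}) = \<mu> * \<bar>h\<bar> / N d"

text \<open>By polarity, \<open>\<mu> * cross2 d z\<close> is at most the norm of \<open>d\<close>
  times the antinorm of \<open>z\<close>, which bounds the antinorm below on the line
  \<open>cross2 d z = h\<close>. Equality holds at a multiple of the quarter turn of a supporting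
  functional at \<open>d\<close>.\<close>

lemma antinorm_plane_isoperimetrix:
  assumes ip: "inner_product ip" and R: "rotation ip (pi / 2) R" and B: "unit_ball B"
  obtains \<mu> where "antinorm_plane (norm_of B) (norm_of (isoperimetrix ip R B)) \<mu>"
proof -
  let ?I = "isoperimetrix ip R B"
  interpret plane_norm "norm_of B" by (rule norm_of_plane_norm[OF B])
  obtain \<mu> where mu: "\<mu> > 0" and I: "?I = {z. \<forall>x\<in>B. \<mu> * cross2 x z \<le> 1}"
    using isoperimetrix_cross2[OF ip R B] .
  have sB: "(- x) \<in> B" if "x \<in> B" for x
    using B that unfolding unit_ball_def by blast
  have sI: "- z \<in> ?I" if "z \<in> ?I" for z
  proof -
    have "\<mu> * cross2 x (- z) \<le> 1" if "x \<in> B" for x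
      using \<open>z \<in> ?I\<close> sB[OF that] by (auto simp: I cross2_simps)
    then show ?thesis by (simp add: I)
  qed
  have "bounded B" using B unfolding unit_ball_def convex_body_def
    using compact_imp_bounded by blast
  then obtain C where C: "C > 0" "\<And>y. y \<in> B \<Longrightarrow> norm y \<le> C"
    by (auto simp: bounded_pos)
  have absorb: "{t. 0 \<le> t \<and> z \<in> (\<lambda>y. t *\<^sub>R y) ` ?I} \<noteq> {}" for z
  proof -
    \<comment> \<open>An upper bound of \<open>\<mu> * cross2 x z\<close> for all
      \<open>x \<in> B\<close>, as vectors in \<open>B\<close> have length at most \<open>C\<close>;
      adding 1 keeps it positive.\<close>
    define t where "t = \<mu> * (2 * C * norm z) + 1"
    have t: "t > 0" using mu C by (auto simp: t_def intro!: add_nonneg_pos)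
    have "\<mu> * cross2 x ((1 / t) *\<^sub>R z) \<le> 1" if "x \<in> B" for x
    proof -
      have "cross2 x z \<le> 2 * norm x * norm z" using cross2_le_norm[of x z] by linarith
      also have "\<dots> \<le> 2 * C * norm z" using C(2)[OF that] by (intro mult_right_mono) auto
      finally have "\<mu> * cross2 x z \<le> \<mu> * (2 * C * norm z)" using mu by simp
      then have "\<mu> * cross2 x z \<le> t" by (simp add: t_def)
      then show ?thesis using t by (simp add: cross2_simps field_simps)
    qed
    then have "(1 / t) *\<^sub>R z \<in> ?I" by (simp add: I)
    moreover have "z = t *\<^sub>R ((1 / t) *\<^sub>R z)" using t by simp
    ultimately have "z \<in> (\<lambda>y. t *\<^sub>R y) ` ?I" by (rule rev_image_eqI)
    then have "t \<in> {t. 0 \<le> t \<and> z \<in> (\<lambda>y. t *\<^sub>R y) ` ?I}" using t by (intro CollectI conjI) auto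
    then show ?thesis by (rule ex_in_conv[THEN iffD1, OF exI])
  qed
  have lower1: "\<mu> * cross2 x z \<le> norm_of ?I z" if x: "x \<in> B" for x z
    unfolding norm_of_def
  proof (rule cInf_greatest[OF absorb])
    fix t assume "t \<in> {t. 0 \<le> t \<and> z \<in> (\<lambda>y. t *\<^sub>R y) ` ?I}"
    then obtain w where w: "0 \<le> t" "z = t *\<^sub>R w" "\<mu> * cross2 x w \<le> 1"
      using x by (auto simp: I)
    have "t * (\<mu> * cross2 x w) \<le> t * 1" using w by (intro mult_left_mono) auto
    then show "\<mu> * cross2 x z \<le> t" by (simp add: w(2) cross2_simps mult_ac)
  qed
  have lower: "\<mu> * cross2 d z \<le> norm_of B d * norm_of ?I z" for d z
  proof (rule tendsto_lowerbound[where F = "at_right (norm_of B d)"])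
    show "((\<lambda>s. s * norm_of ?I z) \<longlongrightarrow> norm_of B d * norm_of ?I z) (at_right (norm_of B d))"
      by (intro tendsto_intros)
    have "\<mu> * cross2 d z \<le> s * norm_of ?I z" if s: "s > norm_of B d" for s
    proof -
      obtain y where y: "y \<in> B" "d = s *\<^sub>R y" using unit_ball_absorbs[OF B s] .
      have "s > 0" using s N_nonneg[of d] by linarith
      then show ?thesis using mult_left_mono[OF lower1[OF y(1), of z], of s]
        by (simp add: y(2) cross2_simps mult_ac)
    qed
    then show "\<forall>\<^sub>F s in at_right (norm_of B d). \<mu> * cross2 d z \<le> s * norm_of ?I z"
      by (auto simp: eventually_at_filter intro!: always_eventually)
  qed simp
  have "Inf (norm_of ?I ` {z. cross2 d z = h}) = \<mu> * \<bar>h\<bar> / norm_of B d" if d: "d \<noteq> 0" for d h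
  proof (rule cInf_eq_minimum)
    have Nd: "norm_of B d > 0" using N_pos d .
    obtain n where n: "n \<bullet> d = norm_of B d" "\<And>x. n \<bullet> x \<le> norm_of B x"
      using supporting_functional[OF d] by blast
    \<comment> \<open>The scaling gives \<open>\<mu> * cross2 x z0 = n \<bullet> x\<close>; as
      \<open>n\<close> is at most 1 on \<open>B\<close>, \<open>z0\<close> lies in the
      isoperimetrix.\<close>
    define z0 where "z0 = (1 / \<mu>) *\<^sub>R (vector [- n $ 2, n $ 1] :: real^2)"
    have z0: "\<mu> * cross2 x z0 = n \<bullet> x" for x
      using mu by (simp add: z0_def cross2_def inner_vec_def sum_2 vector_2 algebra_simps)
    have "z0 \<in> ?I" using n(2) norm_of_le[of _ B 1] by (auto simp: I z0 intro: order_trans)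
    then have pm: "norm_of ?I (t *\<^sub>R z0) \<le> t" "norm_of ?I (t *\<^sub>R (- z0)) \<le> t" if "0 \<le> t" for t
      using sI that by (auto intro!: norm_of_le simp del: scaleR_minus_right)
    have z0_le: "norm_of ?I (t *\<^sub>R z0) \<le> \<bar>t\<bar>" for t
      using pm(1)[of t] pm(2)[of "- t"] by (cases "t \<ge> 0") auto
    define z where "z = (\<mu> * h / norm_of B d) *\<^sub>R z0"
    have "cross2 d z = (\<mu> * cross2 d z0) * h / norm_of B d" by (simp add: z_def cross2_simps)
    then have z: "cross2 d z = h" using Nd by (simp add: z0 n(1))
    have ge: "\<mu> * \<bar>h\<bar> / norm_of B d \<le> norm_of ?I w" if "cross2 d w = h" for w
    proof -
      \<comment> \<open>Using both \<open>d\<close> and \<open>- d\<close> produces the absolute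
        value.\<close>
      have "\<mu> * \<bar>h\<bar> \<le> norm_of B d * norm_of ?I w"
        using lower[of d w] lower[of "- d" w] that by (simp add: cross2_simps abs_if)
      then show ?thesis using Nd by (simp add: field_simps)
    qed
    have "norm_of ?I z \<le> \<mu> * \<bar>h\<bar> / norm_of B d"
      using z0_le[of "\<mu> * h / norm_of B d"] mu Nd by (simp add: z_def abs_mult)
    with ge[OF z] z show "\<mu> * \<bar>h\<bar> / norm_of B d \<in> norm_of ?I ` {z. cross2 d z = h}"
      by (auto intro!: image_eqI[of _ _ z])
    show "\<mu> * \<bar>h\<bar> / norm_of B d \<le> x" if "x \<in> norm_of ?I ` {z. cross2 d z = h}" for x
      using that ge by auto
  qed
  then have "antinorm_plane (norm_of B) (norm_of ?I) \<mu>"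
    by unfold_locales (use mu in auto)
  then show ?thesis by (rule that)
qed

section \<open>Distances of lines, heights and minimum width\<close>

lemma extremal_points:
  assumes "convex_body K"
  obtains x y where "x \<in> K" "y \<in> K"
    "\<And>z. z \<in> K \<Longrightarrow> cross2 d y \<le> cross2 d z \<and> cross2 d z \<le> cross2 d x"
proof -
  have K: "compact K" "K \<noteq> {}" using assms by (auto simp: convex_body_def)
  obtain x where "x \<in> K" "\<And>z. z \<in> K \<Longrightarrow> cross2 d z \<le> cross2 d x"
    using continuous_attains_sup[OF K continuous_on_cross2] by blast
  moreover obtain y where "y \<in> K" "\<And>z. z \<in> K \<Longrightarrow> cross2 d y \<le> cross2 d z"
    using continuous_attains_inf[OF K continuous_on_cross2] by blast
  ultimately show ?thesis using that by blast
qed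

lemma convex_body_hull: "finite S \<Longrightarrow> S \<noteq> {} \<Longrightarrow> convex_body (convex hull S)"
  by (simp add: convex_body_def finite_imp_compact compact_convex_hull)

context antinorm_plane
begin

text \<open>Differences between points of the two lines fill exactly the line
  \<open>cross2 d z = s - s'\<close>, over which the infimum of \<open>N'\<close> is known.\<close>

lemma mink_dist_lines:
  assumes d: "d \<noteq> 0"
  shows "mink_dist N' {x. cross2 d x = s} {x. cross2 d x = s'} = \<mu> * \<bar>s - s'\<bar> / N d"
proof -
  define w where "w = (s' / (d \<bullet> d)) *\<^sub>R (vector [- d $ 2, d $ 1] :: real^2)"
  have "cross2 d (vector [- d $ 2, d $ 1]) = d \<bullet> d"
    by (simp add: cross2_def inner_vec_def sum_2 vector_2)
  then have w: "cross2 d w = s'" using d by (simp add: w_def cross2_simps)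
  have "{N' (x - y) | x y. x \<in> {x. cross2 d x = s} \<and> y \<in> {x. cross2 d x = s'}}
      = N' ` {z. cross2 d z = s - s'}" (is "?L = ?R")
  proof (intro equalityI subsetI)
    fix t assume "t \<in> ?R"
    then obtain z where z: "t = N' z" "cross2 d z = s - s'" by auto
    then have "t = N' ((w + z) - w)" "cross2 d (w + z) = s" using w by (auto simp: cross2_simps)
    then show "t \<in> ?L" using w by blast
  qed (auto simp: cross2_simps)
  then show ?thesis unfolding mink_dist_def using Inf_antinorm[OF d] by simp
qed

lemma mink_height_eq:
  assumes "b \<noteq> c"
  shows "mink_height N' a b c = \<mu> * \<bar>cross2 (b - a) (c - a)\<bar> / N (b - c)"
proof -
  have d: "c - b \<noteq> 0" using assms by simp
  \<comment> \<open>With the line as a level set of \<open>cross2 (c - b)\<close>, the differences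
    between \<open>a\<close> and its points fill another level set.\<close>
  have aff: "affine hull {b, c} = {x. cross2 (c - b) x = cross2 (c - b) b}" (is "_ = ?L")
  proof (intro equalityI subsetI)
    fix x assume "x \<in> affine hull {b, c}"
    then obtain u v where "u + v = 1" "x = u *\<^sub>R b + v *\<^sub>R c" by (auto simp: affine_hull_2)
    then have "x = b + v *\<^sub>R (c - b)" by (simp add: algebra_simps flip: scaleR_add_left)
    then have "cross2 (c - b) x = cross2 (c - b) b + v * cross2 (c - b) (c - b)"
      by (simp only: cross2_simps)
    then show "x \<in> ?L" by (simp only: cross2_simps) simp
  next
    fix x assume "x \<in> ?L"
    then have "cross2 (c - b) (x - b) = 0" by (simp add: cross2_simps)
    then obtain t where "x - b = t *\<^sub>R (c - b)" using cross2_eq_0D d by blast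
    then have "x = (1 - t) *\<^sub>R b + t *\<^sub>R c" by (simp add: algebra_simps)
    then show "x \<in> affine hull {b, c}" unfolding affine_hull_2
      by (intro CollectI exI[of _ "1 - t"] exI[of _ t]) simp
  qed
  have "{N' (x - y) | x y. x \<in> {a} \<and> y \<in> ?L}
      = N' ` {z. cross2 (c - b) z = cross2 (c - b) (a - b)}" (is "?X = ?Y")
  proof (intro equalityI subsetI)
    fix t assume "t \<in> ?Y"
    then obtain z where z: "t = N' z" "cross2 (c - b) z = cross2 (c - b) (a - b)" by auto
    then have "t = N' (a - (a - z))" "a - z \<in> ?L" by (auto simp: cross2_simps)
    then show "t \<in> ?X" by blast
  qed (auto simp: cross2_simps)
  then have "mink_height N' a b c = \<mu> * \<bar>cross2 (c - b) (a - b)\<bar> / N (c - b)"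
    unfolding mink_height_def mink_dist_def aff using Inf_antinorm[OF d] by simp
  then show ?thesis unfolding cross2_triangle_cyclic(1)[where a=a and b=b and c=c] N_diff_commute[of c b] .
qed

text \<open>One direction bounds the minimum width from above: as \<open>x\<close> and
  \<open>y\<close> are extremal in \<open>K\<close>, the lines through them parallel to
  \<open>d\<close> support \<open>K\<close>.\<close>

lemma min_width_le:
  assumes "d \<noteq> 0" "x \<in> K" "y \<in> K" "\<And>z. z \<in> K \<Longrightarrow> cross2 d y \<le> cross2 d z \<and> cross2 d z \<le> cross2 d x"
  shows "min_width N' K \<le> \<mu> * cross2 d (x - y) / N d"
proof -
  let ?l = "\<lambda>s. {z. cross2 d z = s}"
  let ?n = "vector [- d $ 2, d $ 1] :: real^2"
  have "?n \<noteq> 0" using assms(1) by (auto simp: vec_eq_iff forall_2 vector_2)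
  then have "parallel_supporting_lines K (?l (cross2 d y)) (?l (cross2 d x))"
    unfolding parallel_supporting_lines_def using assms
    by (intro exI[of _ ?n] exI[of _ "cross2 d y"] exI[of _ "cross2 d x"])
       (auto simp flip: cross2_eq_inner)
  moreover have "mink_dist N' (?l (cross2 d y)) (?l (cross2 d x)) = \<mu> * cross2 d (x - y) / N d"
    using mink_dist_lines[OF assms(1)] assms(4)[OF assms(2)] by (simp add: cross2_simps)
  moreover have "bdd_below {mink_dist N' l l' | l l'. parallel_supporting_lines K l l'}"
  proof (rule bdd_belowI[of _ 0], clarify)
    fix l l' assume "parallel_supporting_lines K l l'"
    then obtain n s s' where *: "n \<noteq> 0" "l = {x. n \<bullet> x = s}" "l' = {x. n \<bullet> x = s'}"
      unfolding parallel_supporting_lines_def by blast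
    let ?d = "vector [n $ 2, - n $ 1] :: real^2"
    have "?d \<noteq> 0" using *(1) by (auto simp: vec_eq_iff forall_2 vector_2)
    from mink_dist_lines[OF this, of s s'] show "0 \<le> mink_dist N' l l'"
      using mu_pos N_nonneg by (simp add: * inner_eq_cross2)
  qed
  ultimately show ?thesis unfolding min_width_def
    by (intro cInf_lower) (auto, metis)
qed

text \<open>Here \<open>x\<close> and \<open>y\<close> may be any points of \<open>K\<close>, since
  supporting lines with direction \<open>d\<close> are at least as far apart as the parallels
  through \<open>x\<close> and \<open>y\<close>.\<close>

lemma min_width_ge:
  assumes K: "convex_body K"
    and w: "\<And>d. d \<noteq> 0 \<Longrightarrow> \<exists>x\<in>K. \<exists>y\<in>K. w * N d \<le> \<mu> * cross2 d (x - y)"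
  shows "w \<le> min_width N' K"
  unfolding min_width_def
proof (rule cInf_greatest)
  \<comment> \<open>An arbitrary direction supplies one pair of supporting lines, so the infimum is
    over a nonempty set.\<close>
  let ?d = "vector [1, 0] :: real^2"
  let ?n = "vector [- ?d $ 2, ?d $ 1] :: real^2"
  obtain x y where xy: "x \<in> K" "y \<in> K"
    "\<And>z. z \<in> K \<Longrightarrow> cross2 ?d y \<le> cross2 ?d z \<and> cross2 ?d z \<le> cross2 ?d x"
    using extremal_points[OF K] by blast
  have "?n \<noteq> 0" by (auto simp: vec_eq_iff forall_2 vector_2)
  then have "parallel_supporting_lines K {z. ?n \<bullet> z = ?n \<bullet> y} {z. ?n \<bullet> z = ?n \<bullet> x}"
    unfolding parallel_supporting_lines_def using xy(1,2) xy(3)[unfolded cross2_eq_inner]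
    by (intro exI[of _ ?n] exI[of _ "?n \<bullet> y"] exI[of _ "?n \<bullet> x"]) auto
  then show "{mink_dist N' l l' | l l'. parallel_supporting_lines K l l'} \<noteq> {}" by blast
next
  fix t assume "t \<in> {mink_dist N' l l' | l l'. parallel_supporting_lines K l l'}"
  then obtain l l' n s s' where *: "t = mink_dist N' l l'" "n \<noteq> 0" "l = {x. n \<bullet> x = s}"
    "l' = {x. n \<bullet> x = s'}" "\<forall>x\<in>K. s \<le> n \<bullet> x \<and> n \<bullet> x \<le> s'"
    unfolding parallel_supporting_lines_def by blast
  define d :: "real^2" where "d = vector [n $ 2, - n $ 1]"
  have n: "n \<bullet> x = cross2 d x" for x by (simp add: d_def inner_eq_cross2)
  have d: "d \<noteq> 0" using *(2) by (auto simp: d_def vec_eq_iff forall_2 vector_2)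
  obtain x y where xy: "x \<in> K" "y \<in> K" "w * N d \<le> \<mu> * cross2 d (x - y)" using w[OF d] by blast
  have "cross2 d x \<le> s'" "s \<le> cross2 d y" using *(5) xy(1,2) by (simp_all add: n)
  then have "cross2 d (x - y) \<le> \<bar>s - s'\<bar>" by (simp add: cross2_simps)
  then have "w * N d \<le> \<mu> * \<bar>s - s'\<bar>" using xy(3) mu_pos by (meson mult_left_mono less_imp_le order_trans)
  moreover have "t = \<mu> * \<bar>s - s'\<bar> / N d" using mink_dist_lines[OF d] by (simp add: * n)
  ultimately show "w \<le> t" using N_pos[OF d] by (simp add: pos_le_divide_eq)
qed

end

section \<open>Reduced triangles\<close>

context antinorm_plane
begin

text \<open>Twice the signed area times \<open>d\<close> is a combination of the two sides meeting
  at any chosen vertex, with differences of vertex values of \<open>cross2 d\<close> as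
  coefficients. At the vertex with the middle value the differences add up to a spread. If this is
  \<open>a\<close>, the spread is between \<open>b\<close> and \<open>c\<close>; if it is
  \<open>b\<close> or \<open>c\<close>, the factor \<open>1 - \<epsilon>\<close> from the short side
  \<open>b c\<close> shortens the spread exactly to one ending at a cut point.\<close>

lemma truncated_width_bound:
  assumes \<epsilon>: "0 \<le> \<epsilon>"
    and bc: "N (b - c) \<le> (1 - \<epsilon>) * M" and ca: "N (c - a) \<le> M" and ab: "N (a - b) \<le> M"
  shows "\<exists>x \<in> {a + \<epsilon> *\<^sub>R (b - a), a + \<epsilon> *\<^sub>R (c - a), b, c}.
         \<exists>y \<in> {a + \<epsilon> *\<^sub>R (b - a), a + \<epsilon> *\<^sub>R (c - a), b, c}.
           \<bar>cross2 (b - a) (c - a)\<bar> * N d \<le> M * cross2 d (x - y)"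
    (is "\<exists>x\<in>?P. \<exists>y\<in>?P. ?A * N d \<le> M * cross2 d (x - y)")
proof -
  define \<alpha> \<beta> \<gamma> where "\<alpha> = cross2 d a" "\<beta> = cross2 d b" "\<gamma> = cross2 d c"
  note defs = this
  have M: "0 \<le> M" using ca N_nonneg order_trans by blast
  have bnd: "?A * N d \<le> \<bar>s\<bar> * N x + \<bar>t\<bar> * N y"
    if "cross2 (b - a) (c - a) *\<^sub>R d = s *\<^sub>R x + t *\<^sub>R y" for s t x y
    using N_triangle[of "s *\<^sub>R x" "t *\<^sub>R y"] by (simp only: that[symmetric] N_scale)
  \<comment> \<open>Cramer's rule for the sides meeting at \<open>a\<close>, at \<open>b\<close> and
    at \<open>c\<close>, in this order.\<close>
  have "cross2 (b - a) (c - a) *\<^sub>R d = (\<beta> - \<alpha>) *\<^sub>R - (c - a) + (\<gamma> - \<alpha>) *\<^sub>R - (a - b)"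
    "cross2 (b - a) (c - a) *\<^sub>R d = (\<alpha> - \<beta>) *\<^sub>R - (b - c) + (\<gamma> - \<beta>) *\<^sub>R - (a - b)"
    "cross2 (b - a) (c - a) *\<^sub>R d = (\<alpha> - \<gamma>) *\<^sub>R - (b - c) + (\<beta> - \<gamma>) *\<^sub>R - (c - a)"
    by (simp_all add: vec_eq_iff forall_2 cross2_def defs algebra_simps)
  note this[THEN bnd, unfolded N_minus]
  then have A: "?A * N d \<le> \<bar>\<beta> - \<alpha>\<bar> * N (c - a) + \<bar>\<gamma> - \<alpha>\<bar> * N (a - b)"
    and B: "?A * N d \<le> \<bar>\<alpha> - \<beta>\<bar> * N (b - c) + \<bar>\<gamma> - \<beta>\<bar> * N (a - b)"
    and C: "?A * N d \<le> \<bar>\<alpha> - \<gamma>\<bar> * N (b - c) + \<bar>\<beta> - \<gamma>\<bar> * N (c - a)"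
    .
  have A': "?A * N d \<le> M * (\<bar>\<beta> - \<alpha>\<bar> + \<bar>\<gamma> - \<alpha>\<bar>)"
    using A mult_left_mono[OF ca, of "\<bar>\<beta> - \<alpha>\<bar>"] mult_left_mono[OF ab, of "\<bar>\<gamma> - \<alpha>\<bar>"]
    by (simp add: algebra_simps)
  have B': "?A * N d \<le> M * ((1 - \<epsilon>) * \<bar>\<alpha> - \<beta>\<bar> + \<bar>\<gamma> - \<beta>\<bar>)"
    using B mult_left_mono[OF bc, of "\<bar>\<alpha> - \<beta>\<bar>"] mult_left_mono[OF ab, of "\<bar>\<gamma> - \<beta>\<bar>"]
    by (simp add: algebra_simps)
  have C': "?A * N d \<le> M * ((1 - \<epsilon>) * \<bar>\<alpha> - \<gamma>\<bar> + \<bar>\<beta> - \<gamma>\<bar>)"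
    using C mult_left_mono[OF bc, of "\<bar>\<alpha> - \<gamma>\<bar>"] mult_left_mono[OF ca, of "\<bar>\<beta> - \<gamma>\<bar>"]
    by (simp add: algebra_simps)
  have w: ?thesis if "x \<in> ?P" "y \<in> ?P" "?A * N d \<le> M * t" "t = cross2 d (x - y)" for x y t
    using that by blast
  have pt: "cross2 d (a + \<epsilon> *\<^sub>R (b - a)) = \<alpha> + \<epsilon> * (\<beta> - \<alpha>)"
    "cross2 d (a + \<epsilon> *\<^sub>R (c - a)) = \<alpha> + \<epsilon> * (\<gamma> - \<alpha>)"
    by (simp_all add: cross2_simps defs)
  \<comment> \<open>The middle value is \<open>\<alpha>\<close> in the first two cases,
    \<open>\<beta>\<close> in the next two and \<open>\<gamma>\<close> in the last two.\<close>
  consider "\<beta> \<le> \<alpha>" "\<alpha> \<le> \<gamma>" | "\<gamma> \<le> \<alpha>" "\<alpha> \<le> \<beta>" | "\<alpha> \<le> \<beta>" "\<beta> \<le> \<gamma>" | "\<gamma> \<le> \<beta>" "\<beta> \<le> \<alpha>"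
    | "\<alpha> \<le> \<gamma>" "\<gamma> \<le> \<beta>" | "\<beta> \<le> \<gamma>" "\<gamma> \<le> \<alpha>" by linarith
  then show ?thesis
  proof cases
    case 1 then show ?thesis by (intro w[OF _ _ A', of c b]) (auto simp: cross2_simps(4) defs)
  next
    case 2 then show ?thesis by (intro w[OF _ _ A', of b c]) (auto simp: cross2_simps(4) defs)
  next
    case 3 then show ?thesis
      by (intro w[OF _ _ B', of c "a + \<epsilon> *\<^sub>R (b - a)"])
         (simp_all add: cross2_simps(4) pt flip: defs, simp add: algebra_simps)
  next
    case 4 then show ?thesis
      by (intro w[OF _ _ B', of "a + \<epsilon> *\<^sub>R (b - a)" c])
         (simp_all add: cross2_simps(4) pt flip: defs, simp add: algebra_simps)
  next
    case 5 then show ?thesis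
      by (intro w[OF _ _ C', of b "a + \<epsilon> *\<^sub>R (c - a)"])
         (simp_all add: cross2_simps(4) pt flip: defs, simp add: algebra_simps)
  next
    case 6 then show ?thesis
      by (intro w[OF _ _ C', of "a + \<epsilon> *\<^sub>R (c - a)" b])
         (simp_all add: cross2_simps(4) pt flip: defs, simp add: algebra_simps)
  qed
qed

text \<open>With \<open>\<epsilon> = 0\<close> this serves for the whole triangle, with
  \<open>\<epsilon> > 0\<close> for the triangle without its tip at \<open>a\<close>.\<close>

lemma min_width_ge_truncated:
  assumes K: "convex_body K" and sub: "{a + \<epsilon> *\<^sub>R (b - a), a + \<epsilon> *\<^sub>R (c - a), b, c} \<subseteq> K"
    and \<epsilon>: "0 \<le> \<epsilon>" and M: "0 < M"
    and sides: "N (b - c) \<le> (1 - \<epsilon>) * M" "N (c - a) \<le> M" "N (a - b) \<le> M"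
  shows "\<mu> * \<bar>cross2 (b - a) (c - a)\<bar> / M \<le> min_width N' K"
proof (rule min_width_ge[OF K])
  fix d :: "real^2"
  obtain x y where xy: "x \<in> K" "y \<in> K"
    "\<bar>cross2 (b - a) (c - a)\<bar> * N d \<le> M * cross2 d (x - y)"
    using truncated_width_bound[OF \<epsilon> sides, of d] sub by blast
  have "\<mu> * (\<bar>cross2 (b - a) (c - a)\<bar> * N d) \<le> \<mu> * (M * cross2 d (x - y))"
    using xy(3) mu_pos by simp
  then have "\<mu> * \<bar>cross2 (b - a) (c - a)\<bar> / M * N d \<le> \<mu> * cross2 d (x - y)"
    using M by (simp add: field_simps)
  with xy show "\<exists>x\<in>K. \<exists>y\<in>K. \<mu> * \<bar>cross2 (b - a) (c - a)\<bar> / M * N d \<le> \<mu> * cross2 d (x - y)"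
    by blast
qed

text \<open>The direction of the side opposite \<open>a\<close>; the sign \<open>\<sigma>\<close>
  puts \<open>a\<close> on its positive side for either orientation of the triangle.\<close>

lemma edge_direction:
  assumes "cross2 (b - a) (c - a) \<noteq> 0"
  obtains d where "d \<noteq> 0" "N d = N (b - c)" "cross2 d (c - b) = 0"
    "cross2 d (a - b) = \<bar>cross2 (b - a) (c - a)\<bar>"
proof -
  define \<sigma> where "\<sigma> = sgn (cross2 (b - a) (c - a))"
  have s: "\<bar>\<sigma>\<bar> = 1" using assms by (simp add: \<sigma>_def abs_sgn_eq)
  show ?thesis
  proof
    have "b \<noteq> c" using assms by (auto simp: cross2_simps(9))
    then show "\<sigma> *\<^sub>R (c - b) \<noteq> 0" using s by auto
    show "N (\<sigma> *\<^sub>R (c - b)) = N (b - c)" by (simp add: N_scale s N_diff_commute)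
    show "cross2 (\<sigma> *\<^sub>R (c - b)) (c - b) = 0" by (simp only: cross2_simps(5,9) mult_zero_right)
    show "cross2 (\<sigma> *\<^sub>R (c - b)) (a - b) = \<bar>cross2 (b - a) (c - a)\<bar>"
      by (simp only: cross2_simps(5) cross2_triangle_cyclic[where a=a and b=b and c=c] \<sigma>_def) (simp add: abs_sgn mult.commute)
  qed
qed

text \<open>\<open>t\<close> is the weight of \<open>a\<close> in a convex combination giving
  \<open>x\<close>; weight 1 leaves only \<open>a\<close>.\<close>

lemma hull_edge_coordinate:
  assumes "x \<in> convex hull {a, b, c}" "cross2 d (c - b) = 0" "cross2 d (a - b) = A"
  obtains t where "0 \<le> t" "t \<le> 1" "cross2 d x = cross2 d b + t * A" "t = 1 \<Longrightarrow> x = a"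
proof -
  obtain u v w where *: "0 \<le> u" "0 \<le> v" "0 \<le> w" "u + v + w = 1"
    "x = u *\<^sub>R a + v *\<^sub>R b + w *\<^sub>R c"
    using assms(1) by (auto simp: convex_hull_3)
  have b: "cross2 d c = cross2 d b" "cross2 d a = cross2 d b + A"
    using assms(2,3) by (simp_all add: cross2_simps)
  show ?thesis
  proof
    show "cross2 d x = cross2 d b + u * A"
    proof -
      have "cross2 d x = (u + v + w) * cross2 d b + u * A"
        by (simp add: *(5) cross2_simps b algebra_simps)
      then show ?thesis using *(4) by simp
    qed
    show "x = a" if "u = 1"
    proof -
      have "v = 0" "w = 0" using * that by linarith+
      then show ?thesis using *(5) that by simp
    qed
  qed (use * in auto)
qed

lemma min_width_triangle_le:
  assumes tri: "cross2 (b - a) (c - a) \<noteq> 0"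
  shows "min_width N' (convex hull {a, b, c}) \<le> \<mu> * \<bar>cross2 (b - a) (c - a)\<bar> / N (b - c)"
proof -
  let ?A = "\<bar>cross2 (b - a) (c - a)\<bar>"
  obtain d where d: "d \<noteq> 0" "N d = N (b - c)" "cross2 d (c - b) = 0" "cross2 d (a - b) = ?A"
    using edge_direction[OF tri] .
  have "cross2 d b \<le> cross2 d z \<and> cross2 d z \<le> cross2 d a" if z: "z \<in> convex hull {a, b, c}" for z
  proof -
    obtain t where "0 \<le> t" "t \<le> 1" "cross2 d z = cross2 d b + t * ?A"
      using hull_edge_coordinate[OF z d(3,4)] .
    moreover have "cross2 d a = cross2 d b + ?A" using d(4) by (simp add: cross2_simps(4))
    ultimately show ?thesis using mult_left_le_one_le[of ?A t] by simp
  qed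
  then have "min_width N' (convex hull {a, b, c}) \<le> \<mu> * cross2 d (a - b) / N d"
    by (intro min_width_le[OF d(1)]) (auto intro: hull_inc)
  then show ?thesis by (simp only: d)
qed

text \<open>Compactness gives strictness: the largest value of \<open>cross2 d\<close> on
  \<open>K\<close> is attained at a point other than \<open>a\<close>, so its weight
  \<open>t\<close> at \<open>a\<close> is below 1.\<close>

lemma min_width_less_if_vertex_missing:
  assumes tri: "cross2 (b - a) (c - a) \<noteq> 0"
    and K: "convex_body K" "K \<subseteq> convex hull {a, b, c}" "a \<notin> K"
  shows "min_width N' K < \<mu> * \<bar>cross2 (b - a) (c - a)\<bar> / N (b - c)"
proof -
  let ?A = "\<bar>cross2 (b - a) (c - a)\<bar>"
  obtain d where d: "d \<noteq> 0" "N d = N (b - c)" "cross2 d (c - b) = 0" "cross2 d (a - b) = ?A"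
    using edge_direction[OF tri] .
  obtain x y where xy: "x \<in> K" "y \<in> K"
    "\<And>z. z \<in> K \<Longrightarrow> cross2 d y \<le> cross2 d z \<and> cross2 d z \<le> cross2 d x"
    using extremal_points[OF K(1)] by blast
  obtain t where t: "0 \<le> t" "t \<le> 1" "cross2 d x = cross2 d b + t * ?A" "t = 1 \<Longrightarrow> x = a"
    using hull_edge_coordinate[OF _ d(3,4), of x] K(2) xy(1) by blast
  obtain s where s: "0 \<le> s" "s \<le> 1" "cross2 d y = cross2 d b + s * ?A"
    using hull_edge_coordinate[OF _ d(3,4), of y] K(2) xy(2) by blast
  have "t < 1" using t K(3) xy(1) by fastforce
  then have "t * ?A < 1 * ?A" using tri by (intro mult_strict_right_mono) auto
  moreover have "0 \<le> s * ?A" using s by simp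
  moreover have "cross2 d (x - y) = t * ?A - s * ?A"
    by (simp only: cross2_simps(4) t(3) s(3))
  ultimately have "cross2 d (x - y) < ?A" by linarith
  then have "\<mu> * cross2 d (x - y) / N d < \<mu> * ?A / N d"
    using mu_pos N_pos[OF d(1)] by (intro divide_strict_right_mono mult_strict_left_mono)
  with min_width_le[OF d(1) xy] show ?thesis by (simp add: d(2))
qed

lemma reduced_if_equilateral:
  assumes tri: "cross2 (b - a) (c - a) \<noteq> 0" and eq: "equilateral N a b c"
  shows "reduced_body N' (convex hull {a, b, c})"
  unfolding reduced_body_def
proof (intro conjI allI impI)
  let ?T = "convex hull {a, b, c}"
  show cb: "convex_body ?T" by (rule convex_body_hull) auto
  fix K assume K: "convex_body K \<and> K \<subset> ?T"
  define L where "L = N (b - c)"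
  have L: "N (b - c) = L" "N (c - a) = L" "N (a - b) = L"
    using eq by (auto simp: equilateral_def L_def)
  have "b \<noteq> c" using tri by (auto simp: cross2_simps(9))
  then have "L > 0" unfolding L_def by (intro N_pos) simp
  then have W: "\<mu> * \<bar>cross2 (b - a) (c - a)\<bar> / L \<le> min_width N' ?T"
    by (intro min_width_ge_truncated[of _ _ 0]) (auto simp: L cb intro: hull_inc)
  \<comment> \<open>A convex set containing all vertices contains the triangle, so a proper subbody
    misses one of them.\<close>
  have "\<not> {a, b, c} \<subseteq> K"
    using K hull_minimal[of "{a, b, c}" K convex] by (auto simp: convex_body_def)
  then consider "a \<notin> K" | "b \<notin> K" | "c \<notin> K" by blast
  then have "min_width N' K < \<mu> * \<bar>cross2 (b - a) (c - a)\<bar> / L"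
  proof cases
    case 1
    with min_width_less_if_vertex_missing[OF tri, of K] K show ?thesis by (auto simp: L)
  next
    case 2
    have "K \<subseteq> convex hull {b, c, a}" using K by (auto simp: insert_commute)
    with 2 min_width_less_if_vertex_missing[of c b a K] K tri show ?thesis
      by (simp add: L cross2_triangle_cyclic[where a=a and b=b and c=c])
  next
    case 3
    have "K \<subseteq> convex hull {c, a, b}" using K by (auto simp: insert_commute)
    with 3 min_width_less_if_vertex_missing[of a c b K] K tri show ?thesis
      by (simp add: L cross2_triangle_cyclic[where a=a and b=b and c=c])
  qed
  with W show "min_width N' K < min_width N' ?T" by linarith
qed

text \<open>Otherwise let \<open>M\<close> be the larger of the other two lengths. After cutting off
  the tip at \<open>a\<close>, the minimum width is still at least the height over a side of length
  \<open>M\<close>, and the minimum width of the whole triangle is at most that height. This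
  contradicts reducedness.\<close>

lemma reduced_longest_side:
  assumes tri: "cross2 (b - a) (c - a) \<noteq> 0" and red: "reduced_body N' (convex hull {a, b, c})"
  shows "max (N (c - a)) (N (a - b)) \<le> N (b - c)"
proof (rule ccontr)
  let ?A = "\<bar>cross2 (b - a) (c - a)\<bar>" and ?T = "convex hull {a, b, c}"
  define M where "M = max (N (c - a)) (N (a - b))"
  assume "\<not> max (N (c - a)) (N (a - b)) \<le> N (b - c)"
  then have lt: "N (b - c) < M" unfolding M_def by (rule not_le_imp_less)
  then have M: "0 < M" using N_nonneg[of "b - c"] by linarith
  \<comment> \<open>The deepest cut that \<open>min_width_ge_truncated\<close> allows, with
    \<open>(1 - \<epsilon>) * M\<close> equal to the length of \<open>b c\<close>.\<close>
  define \<epsilon> where "\<epsilon> = 1 - N (b - c) / M"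
  have \<epsilon>: "0 < \<epsilon>" "\<epsilon> \<le> 1" "(1 - \<epsilon>) * M = N (b - c)"
    using lt M N_nonneg by (auto simp: \<epsilon>_def)
  let ?P = "{a + \<epsilon> *\<^sub>R (b - a), a + \<epsilon> *\<^sub>R (c - a), b, c}"
  have ge: "\<mu> * ?A / M \<le> min_width N' (convex hull ?P)"
    by (rule min_width_ge_truncated[of _ _ \<epsilon>])
       (use \<epsilon> M in \<open>auto simp: M_def intro!: convex_body_hull hull_inc\<close>)
  have le: "min_width N' ?T \<le> \<mu> * ?A / M"
  proof (cases "N (c - a) \<le> N (a - b)")
    case True
    then show ?thesis using min_width_triangle_le[of a c b] tri
      by (simp add: M_def insert_commute cross2_triangle_cyclic[where a=a and b=b and c=c])
  next
    case False
    then show ?thesis using min_width_triangle_le[of c b a] tri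
      by (simp add: M_def insert_commute cross2_triangle_cyclic[where a=a and b=b and c=c])
  qed
  have sub: "convex hull ?P \<subseteq> ?T"
  proof (rule hull_minimal)
    have "(1 - \<epsilon>) *\<^sub>R a + \<epsilon> *\<^sub>R x \<in> ?T" if "x \<in> {b, c}" for x
      using \<epsilon> that by (intro convexD[OF convex_convex_hull]) (auto intro: hull_inc)
    then have "a + \<epsilon> *\<^sub>R (x - a) \<in> ?T" if "x \<in> {b, c}" for x
      using that by (simp add: algebra_simps)
    then show "?P \<subseteq> ?T" by (auto intro: hull_inc)
  qed (rule convex_convex_hull)
  \<comment> \<open>The half-plane bounded by the line of the cut contains the four points, while
    \<open>a\<close> lies beyond it.\<close>
  have "a \<notin> convex hull ?P"
  proof -
    obtain d where d: "d \<noteq> 0" "cross2 d (c - b) = 0" "cross2 d (a - b) = ?A"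
      using edge_direction[OF tri] by metis
    have b: "cross2 d c = cross2 d b" "cross2 d a = cross2 d b + ?A"
      using d by (simp_all add: cross2_simps(4))
    have "0 \<le> (1 - \<epsilon>) * ?A" using \<epsilon> by simp
    then have "?P \<subseteq> {z. cross2 d z \<le> cross2 d b + (1 - \<epsilon>) * ?A}"
      by (simp add: cross2_simps(2,4,6) b algebra_simps)
    moreover have "convex {z. cross2 d z \<le> cross2 d b + (1 - \<epsilon>) * ?A}"
      unfolding cross2_eq_inner by (rule convex_halfspace_le)
    ultimately have "convex hull ?P \<subseteq> {z. cross2 d z \<le> cross2 d b + (1 - \<epsilon>) * ?A}"
      by (rule hull_minimal)
    moreover have "0 < \<epsilon> * ?A" using \<epsilon> tri by simp
    ultimately show ?thesis by (auto simp: b(2) algebra_simps)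
  qed
  moreover have "a \<in> ?T" by (simp add: hull_inc)
  ultimately have "convex hull ?P \<subset> ?T" using sub by blast
  moreover have "convex_body (convex hull ?P)" by (rule convex_body_hull) auto
  ultimately have "min_width N' (convex hull ?P) < min_width N' ?T"
    using red unfolding reduced_body_def by blast
  with ge le show False by linarith
qed

lemma reduced_iff_equilateral:
  assumes tri: "is_triangle a b c"
  shows "reduced_body N' (convex hull {a, b, c}) \<longleftrightarrow> equilateral N a b c"
proof
  note A = triangle_cross2_nonzero[OF tri]
  then have B: "cross2 (c - b) (a - b) \<noteq> 0" and C: "cross2 (a - c) (b - c) \<noteq> 0"
    by (simp_all add: cross2_triangle_cyclic[where a=a and b=b and c=c])
  assume red: "reduced_body N' (convex hull {a, b, c})"
  \<comment> \<open>With each vertex in turn as the tip, every side is a longest one.\<close>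
  then have "reduced_body N' (convex hull {b, c, a})" "reduced_body N' (convex hull {c, a, b})"
    by (simp_all add: insert_commute)
  with reduced_longest_side[OF A red] reduced_longest_side[OF B] reduced_longest_side[OF C]
  show "equilateral N a b c" by (auto simp: equilateral_def)
qed (rule reduced_if_equilateral[OF triangle_cross2_nonzero[OF tri]])

lemma equal_heights_iff_equilateral:
  assumes tri: "is_triangle a b c"
  shows "equal_heights N' a b c \<longleftrightarrow> equilateral N a b c"
proof -
  note A = triangle_cross2_nonzero[OF tri]
  have ne: "b \<noteq> c" "c \<noteq> a" "a \<noteq> b" using A by (auto simp: cross2_simps(9) cross2_def)
  then have pos: "N (b - c) > 0" "N (c - a) > 0" "N (a - b) > 0" by (auto intro: N_pos)
  have h: "\<mu> * \<bar>cross2 (b - a) (c - a)\<bar> > 0" using mu_pos A by simp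
  have "h / s = h / t \<longleftrightarrow> s = t" if "h > 0" "s > 0" "t > 0" for h s t :: real
    using that by (auto simp: field_simps)
  note this[OF h]
  then show ?thesis
    using pos unfolding equal_heights_def equilateral_def
    by (simp add: mink_height_eq ne cross2_triangle_cyclic[where a=a and b=b and c=c])
qed

end

section \<open>The median triangle\<close>

text \<open>A segment determines its endpoints only up to order, hence its direction vector only up
  to sign.\<close>

lemma translate_segment_direction:
  assumes "translate_of (closed_segment x y) (closed_segment z w)"
  shows "y - x = w - z \<or> y - x = - (w - z)"
proof -
  obtain v where "closed_segment x y = (\<lambda>u. v + u) ` closed_segment z w"
    using assms unfolding translate_of_def by blast
  then have "closed_segment x y = closed_segment (v + z) (v + w)"
    by (simp add: closed_segment_translation)
  then have "{x, y} = {v + z, v + w}" by (simp add: closed_segment_eq)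
  then show ?thesis by (auto simp: doubleton_eq_iff)
qed

text \<open>For a nondegenerate triangle this shows that the medians are not parallel: they are
  three distinct segments, and two of them give a basis.\<close>

lemma medians_cross2:
  fixes a b c :: "real^2"
  shows "cross2 (midpoint b c - a) (midpoint c a - b) = 3/4 * cross2 (b - a) (c - a)"
  by (simp add: cross2_def midpoint_def algebra_simps)

lemma closed_segment_neq_if_cross2:
  assumes "cross2 (y - x) (w - z) \<noteq> 0"
  shows "closed_segment x y \<noteq> closed_segment z w"
proof
  assume "closed_segment x y = closed_segment z w"
  then have "w - z = y - x \<or> w - z = - (y - x)"
    by (auto simp: closed_segment_eq doubleton_eq_iff)
  with assms show False by (auto simp only: cross2_simps(8,9) neg_equal_0_iff_equal)
qed

text \<open>The bijection between the sets of medians and sides fixes no order of the sides. Since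
  the medians are distinct, it is one of six matchings, each absorbed by relabelling the
  vertices.\<close>

lemma median_triangle_correspondence:
  assumes tri: "is_triangle a b c" and med: "median_triangle a b c p q r"
  obtains p' q' r' where
    "(p', q', r') \<in> {(p, q, r), (q, r, p), (r, p, q), (p, r, q), (r, q, p), (q, p, r)}"
    "translate_of (closed_segment q' r') (closed_segment a (midpoint b c))"
    "translate_of (closed_segment r' p') (closed_segment b (midpoint c a))"
    "translate_of (closed_segment p' q') (closed_segment c (midpoint a b))"
proof -
  define M1 M2 M3 where "M1 = closed_segment a (midpoint b c)"
    "M2 = closed_segment b (midpoint c a)" "M3 = closed_segment c (midpoint a b)"
  define S1 S2 S3 where "S1 = closed_segment q r" "S2 = closed_segment r p" "S3 = closed_segment p q"
  note M = M1_M2_M3_def and S = S1_S2_S3_def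
  obtain f where f: "bij_betw f {M1, M2, M3} {S1, S2, S3}"
    "\<forall>m\<in>{M1, M2, M3}. translate_of (f m) m"
    using med unfolding median_triangle_def medians_def sides_def M S by blast
  have "M1 \<noteq> M2" "M2 \<noteq> M3" "M3 \<noteq> M1"
    unfolding M using triangle_cross2_nonzero[OF tri]
    by (intro closed_segment_neq_if_cross2; simp add: medians_cross2 cross2_triangle_cyclic[where a=a and b=b and c=c])+
  then have inj: "f M1 \<noteq> f M2" "f M2 \<noteq> f M3" "f M3 \<noteq> f M1"
    using f(1) unfolding bij_betw_def inj_on_def by blast+
  have "f M1 \<in> {S1, S2, S3}" "f M2 \<in> {S1, S2, S3}" "f M3 \<in> {S1, S2, S3}"
    using bij_betwE[OF f(1)] by (simp_all only: ball_simps simp_thms)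
  then consider
      "f M1 = S1" "f M2 = S2" "f M3 = S3" | "f M1 = S1" "f M2 = S3" "f M3 = S2"
    | "f M1 = S2" "f M2 = S1" "f M3 = S3" | "f M1 = S2" "f M2 = S3" "f M3 = S1"
    | "f M1 = S3" "f M2 = S1" "f M3 = S2" | "f M1 = S3" "f M2 = S2" "f M3 = S1"
    using inj by (elim insertE emptyE) simp_all
  then show ?thesis
  proof cases
    case 1 then show ?thesis using f(2) that[of p q r] by (simp add: M S closed_segment_commute)
  next
    case 2 then show ?thesis using f(2) that[of p r q] by (simp add: M S closed_segment_commute)
  next
    case 3 then show ?thesis using f(2) that[of q p r] by (simp add: M S closed_segment_commute)
  next
    case 4 then show ?thesis using f(2) that[of q r p] by (simp add: M S closed_segment_commute)
  next
    case 5 then show ?thesis using f(2) that[of r p q] by (simp add: M S closed_segment_commute)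
  next
    case 6 then show ?thesis using f(2) that[of r q p] by (simp add: M S closed_segment_commute)
  qed
qed

text \<open>As \<open>x\<close> and \<open>y\<close> are independent, a linear relation among
  \<open>x\<close>, \<open>y\<close> and \<open>z\<close> is unique up to a scalar. The signs are
  the coefficients of such a relation, hence all equal.\<close>

lemma common_sign:
  fixes x y z :: "real^2"
  assumes sum: "x + y + z = 0" and xy: "cross2 x y \<noteq> 0"
    and "X = x \<or> X = - x" "Y = y \<or> Y = - y" "Z = z \<or> Z = - z" and SUM: "X + Y + Z = 0"
  obtains \<sigma> :: real where "\<bar>\<sigma>\<bar> = 1" "X = \<sigma> *\<^sub>R x" "Y = \<sigma> *\<^sub>R y" "Z = \<sigma> *\<^sub>R z"
proof -
  have sgn: "\<exists>s::real. \<bar>s\<bar> = 1 \<and> V = s *\<^sub>R v" if "V = v \<or> V = - v" for V v :: "real^2"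
    using that by (auto intro: exI[of _ 1] exI[of _ "-1"])
  obtain \<alpha> \<beta> \<gamma> :: real where *: "\<bar>\<alpha>\<bar> = 1" "X = \<alpha> *\<^sub>R x" "Y = \<beta> *\<^sub>R y" "Z = \<gamma> *\<^sub>R z"
    using assms(3-5) sgn by metis
  have z: "z = - x - y" using sum by (simp add: algebra_simps eq_neg_iff_add_eq_0)
  have "(\<alpha> - \<gamma>) *\<^sub>R x + (\<beta> - \<gamma>) *\<^sub>R y = 0"
    using SUM by (simp add: * z algebra_simps)
  then have "cross2 ((\<alpha> - \<gamma>) *\<^sub>R x + (\<beta> - \<gamma>) *\<^sub>R y) y = 0"
    "cross2 x ((\<alpha> - \<gamma>) *\<^sub>R x + (\<beta> - \<gamma>) *\<^sub>R y) = 0"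
    by (simp_all only: cross2_simps)
  then have "\<alpha> = \<gamma>" "\<beta> = \<gamma>" using xy by (simp_all only: cross2_simps) auto
  with * show ?thesis by (intro that[of \<alpha>]) auto
qed

context plane_norm
begin

lemma permuted_triangle:
  assumes "(p', q', r') \<in> {(p, q, r), (q, r, p), (r, p, q), (p, r, q), (r, q, p), (q, p, r)}"
  shows "equilateral N p' q' r' \<longleftrightarrow> equilateral N p q r"
    and "AG_quasiregular N p' q' r' \<longleftrightarrow> AG_quasiregular N p q r"
  using assms
  by (auto simp: equilateral_def AG_quasiregular_def circumcenter_def centroid_def
      N_diff_commute[of p q] N_diff_commute[of q r] N_diff_commute[of r p] add_ac)

lemma median_triangle_duality:
  assumes tri: "is_triangle a b c" and med: "median_triangle a b c p q r"
  shows "AG_quasiregular N a b c \<longleftrightarrow> equilateral N p q r"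
    and "equilateral N a b c \<longleftrightarrow> AG_quasiregular N p q r"
proof -
  obtain p' q' r' where
    perm: "(p', q', r') \<in> {(p, q, r), (q, r, p), (r, p, q), (p, r, q), (r, q, p), (q, p, r)}"
    and tr: "translate_of (closed_segment q' r') (closed_segment a (midpoint b c))"
      "translate_of (closed_segment r' p') (closed_segment b (midpoint c a))"
      "translate_of (closed_segment p' q') (closed_segment c (midpoint a b))"
    using median_triangle_correspondence[OF tri med] .
  have sum: "(midpoint b c - a) + (midpoint c a - b) + (midpoint a b - c) = 0"
    by (simp add: vec_eq_iff midpoint_def field_simps)
  have "cross2 (midpoint b c - a) (midpoint c a - b) \<noteq> 0"
    using triangle_cross2_nonzero[OF tri] by (simp add: medians_cross2)
  moreover have "(r' - q') + (p' - r') + (q' - p') = 0" by simp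
  ultimately obtain \<sigma> where s: "\<bar>\<sigma>\<bar> = 1" and E: "r' - q' = \<sigma> *\<^sub>R (midpoint b c - a)"
    "p' - r' = \<sigma> *\<^sub>R (midpoint c a - b)" "q' - p' = \<sigma> *\<^sub>R (midpoint a b - c)"
    using common_sign[OF sum _ tr[THEN translate_segment_direction]] by metis
  let ?g = "centroid a b c" and ?g' = "centroid p' q' r'"
  \<comment> \<open>A median is \<open>3 / 2\<close> times the vector between its vertex and the
    centroid.\<close>
  have "q' - r' = (3 / 2 * \<sigma>) *\<^sub>R (a - ?g)" "r' - p' = (3 / 2 * \<sigma>) *\<^sub>R (b - ?g)"
    "p' - q' = (3 / 2 * \<sigma>) *\<^sub>R (c - ?g)"
    using E by (auto simp: vec_eq_iff centroid_def midpoint_def field_simps)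
  then have N: "N (q' - r') = 3 / 2 * N (a - ?g)" "N (r' - p') = 3 / 2 * N (b - ?g)"
    "N (p' - q') = 3 / 2 * N (c - ?g)"
    using s by (simp_all add: N_scale abs_mult)
  have "AG_quasiregular N a b c \<longleftrightarrow> equilateral N p' q' r'"
    by (auto simp: AG_quasiregular_def circumcenter_def equilateral_def N)
  then show "AG_quasiregular N a b c \<longleftrightarrow> equilateral N p q r"
    by (simp add: permuted_triangle[OF perm])
  \<comment> \<open>The vector from the centroid to a vertex is a third of the difference of the
    side vectors there; for sides that are medians, this difference is, up to sign,
    \<open>3 / 2\<close> of a side of the original triangle.\<close>
  have "p' - ?g' = (1 / 3) *\<^sub>R ((p' - r') - (q' - p'))" "q' - ?g' = (1 / 3) *\<^sub>R ((q' - p') - (r' - q'))"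
    "r' - ?g' = (1 / 3) *\<^sub>R ((r' - q') - (p' - r'))"
    by (simp_all add: vec_eq_iff centroid_def field_simps)
  then have "p' - ?g' = (1 / 2 * - \<sigma>) *\<^sub>R (b - c)" "q' - ?g' = (1 / 2 * - \<sigma>) *\<^sub>R (c - a)"
    "r' - ?g' = (1 / 2 * - \<sigma>) *\<^sub>R (a - b)"
    unfolding E by (simp_all add: vec_eq_iff midpoint_def field_simps)
  then have N': "N (p' - ?g') = 1 / 2 * N (b - c)" "N (q' - ?g') = 1 / 2 * N (c - a)"
    "N (r' - ?g') = 1 / 2 * N (a - b)"
    using s by (simp_all add: N_scale abs_mult)
  have "equilateral N a b c \<longleftrightarrow> AG_quasiregular N p' q' r'"
    by (auto simp: AG_quasiregular_def circumcenter_def equilateral_def N')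
  then show "equilateral N a b c \<longleftrightarrow> AG_quasiregular N p q r"
    by (simp add: permuted_triangle[OF perm])
qed

end

theorem theorem4p4:
  fixes B :: "(real^2) set"
    and ip :: "real^2 \<Rightarrow> real^2 \<Rightarrow> real"
    and R :: "real^2 \<Rightarrow> real^2"
    and a b c p q r :: "real^2"
  assumes "unit_ball B"
    and "inner_product ip"
    and "rotation ip (pi / 2) R"
    and "is_triangle a b c"
    and "median_triangle a b c p q r"
  defines "N \<equiv> norm_of B"
    and "N' \<equiv> norm_of (isoperimetrix ip R B)"
  shows "((AG_quasiregular N a b c \<longleftrightarrow> equilateral N p q r) \<and>
          (equilateral N p q r \<longleftrightarrow> reduced_body N' (convex hull {p, q, r})) \<and>
          (reduced_body N' (convex hull {p, q, r}) \<longleftrightarrow> equal_heights N' p q r)) \<and>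
         ((equilateral N a b c \<longleftrightarrow> AG_quasiregular N p q r) \<and>
          (AG_quasiregular N p q r \<longleftrightarrow> reduced_body N' (convex hull {a, b, c})) \<and>
          (reduced_body N' (convex hull {a, b, c}) \<longleftrightarrow> equal_heights N' a b c))"
proof -
  obtain \<mu> where "antinorm_plane N N' \<mu>"
    using antinorm_plane_isoperimetrix[OF assms(2,3,1)] unfolding N_def N'_def .
  then interpret antinorm_plane N N' \<mu> .
  have tri': "is_triangle p q r"
    using assms(5) unfolding median_triangle_def by blast
  show ?thesis
    unfolding reduced_iff_equilateral[OF assms(4)] reduced_iff_equilateral[OF tri']
      equal_heights_iff_equilateral[OF assms(4)] equal_heights_iff_equilateral[OF tri']
      median_triangle_duality[OF assms(4,5), symmetric]
    by (simp add: median_triangle_duality(1)[OF assms(4,5)])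
qed

end
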